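(* Let $L$ be a complete orthomodular lattice and let $j:L\to L$ be a map satisfying the Borceux-Van den Bossche conditions. Then the subset $L_j=\{x\in L\mid j(x)=x\}$ of $L$ is a complete boolean sublattice of $L$ contained in the center $Z_F(L)$ of $L$.
   Context: A complete orthomodular lattice is a complete lattice $L$ (least element $0$, greatest element $1$) with a unary operation $\perp:L\to L$ such that, for all $a,b,a_i\in L$ and any index set $I$: $a^{\perp\perp}=a$; $(\bigvee_{i\in I}a_i)^\perp=\bigwedge_{i\in I}a_i^\perp$; $a\vee a^\perp=1$; $a\wedge a^\perp=0$; and if $a\le b$ then $b=a\vee(a^\perp\wedge b)$. For $a,b\in L$ put $a\,\&^F b=(a\vee b^\perp)\wedge b$. The center of $L$ is $Z_F(L)=\{a\in L\mid a\,\&^F b=b\,\&^F a=a\wedge b \text{ for all } b\in L\}$. A complete boolean sublattice (equivalently here, complete boolean subalgebra) of $L$ is a subset of $L$ that is closed under arbitrary joins and meets (computed in $L$, including the empty ones) and under $\perp$, and that is a boolean algebra under the inherited operations. A map (called an "endomorphism" in this setting; it is not required to be a lattice homomorphism) $j:L\to L$ satisfies the Borceux-Van den Bossche conditions if it is a closure operation (order preserving, $a\le j(a)$, $j(j(a))=j(a)$) and, for all $a,b,a_i,b_i\in L$ and every index set $I$ (possibly empty): 1. $a\le j(a)$; 2. $j(a\wedge j(b))=j(a)\wedge j(b)$; 3. $a\wedge j(\bigvee_{i\in I}b_i)=\bigvee_{i\in I}(a\wedge j(b_i))$; 4. $(\bigvee_{i\in I}a_i)\wedge j(b)=\bigvee_{i\in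 I}(a_i\wedge j(b))$. *)

theory Defs
  imports Main "HOL-Library.Complemented_Lattices"
begin

unbundle lattice_syntax

definition sasaki_and :: "'a::complete_orthomodular_lattice \<Rightarrow> 'a \<Rightarrow> 'a" where
  "sasaki_and a b = (a \<squnion> - b) \<sqinter> b"

definition center :: "'a::complete_orthomodular_lattice set" where
  "center = {a. \<forall>b. sasaki_and a b = a \<sqinter> b \<and> sasaki_and b a = a \<sqinter> b}"

text \<open>The axioms of \<^locale>\<open>abstract_boolean_algebra\<close>, relativised to a carrier set.\<close>

locale boolean_algebra_on =
  fixes S :: "'a set"
    and conj disj :: "'a \<Rightarrow> 'a \<Rightarrow> 'a"
    and compl :: "'a \<Rightarrow> 'a"
    and zero one :: 'a
  assumes conj_closed: "x \<in> S \<Longrightarrow> y \<in> S \<Longrightarrow> conj x y \<in> S"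
    and disj_closed: "x \<in> S \<Longrightarrow> y \<in> S \<Longrightarrow> disj x y \<in> S"
    and compl_closed: "x \<in> S \<Longrightarrow> compl x \<in> S"
    and zero_closed: "zero \<in> S"
    and one_closed: "one \<in> S"
    and conj_assoc: "x \<in> S \<Longrightarrow> y \<in> S \<Longrightarrow> z \<in> S \<Longrightarrow> conj (conj x y) z = conj x (conj y z)"
    and conj_commute: "x \<in> S \<Longrightarrow> y \<in> S \<Longrightarrow> conj x y = conj y x"
    and disj_assoc: "x \<in> S \<Longrightarrow> y \<in> S \<Longrightarrow> z \<in> S \<Longrightarrow> disj (disj x y) z = disj x (disj y z)"
    and disj_commute: "x \<in> S \<Longrightarrow> y \<in> S \<Longrightarrow> disj x y = disj y x"
    and conj_disj_distrib:
      "x \<in> S \<Longrightarrow> y \<in> S \<Longrightarrow> z \<in> S \<Longrightarrow> conj x (disj y z) = disj (conj x y) (conj x z)"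
    and disj_conj_distrib:
      "x \<in> S \<Longrightarrow> y \<in> S \<Longrightarrow> z \<in> S \<Longrightarrow> disj x (conj y z) = conj (disj x y) (disj x z)"
    and conj_one_right: "x \<in> S \<Longrightarrow> conj x one = x"
    and disj_zero_right: "x \<in> S \<Longrightarrow> disj x zero = x"
    and conj_cancel_right: "x \<in> S \<Longrightarrow> conj x (compl x) = zero"
    and disj_cancel_right: "x \<in> S \<Longrightarrow> disj x (compl x) = one"

definition complete_boolean_sublattice :: "'a::complete_orthomodular_lattice set \<Rightarrow> bool" where
  "complete_boolean_sublattice S \<longleftrightarrow>
     (\<forall>A\<subseteq>S. \<Squnion>A \<in> S) \<and> (\<forall>A\<subseteq>S. \<Sqinter>A \<in> S) \<and> (\<forall>x\<in>S. - x \<in> S) \<and>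
     boolean_algebra_on S (\<sqinter>) (\<squnion>) uminus \<bottom> \<top>"

locale closure_operation =
  fixes j :: "'a::order \<Rightarrow> 'a"
  assumes mono_closure: "mono j"
    and closure_increasing: "a \<le> j a"
    and closure_idem: "j (j a) = j a"

text \<open>
  The first Borceux-Van den Bossche condition, that a is below j a, is already part of
  \<^locale>\<open>closure_operation\<close>. The conditions on families are stated for subsets, since a
  locale assumption cannot range over all index types; the lemmas below recover arbitrary
  (possibly empty) families.
\<close>

locale borceux_van_den_bossche = closure_operation j
  for j :: "'a::complete_lattice \<Rightarrow> 'a" +
  assumes closure_inf_closure: "j (a \<sqinter> j b) = j a \<sqinter> j b"
    and inf_closure_Sup: "a \<sqinter> j (\<Squnion>B) = (\<Squnion>b\<in>B. a \<sqinter> j b)"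
    and Sup_inf_closure: "\<Squnion>A \<sqinter> j b = (\<Squnion>a\<in>A. a \<sqinter> j b)"
begin

lemma inf_closure_SUP: "a \<sqinter> j (\<Squnion>i\<in>I. f i) = (\<Squnion>i\<in>I. a \<sqinter> j (f i))"
  by (simp add: inf_closure_Sup image_image)

lemma SUP_inf_closure: "(\<Squnion>i\<in>I. f i) \<sqinter> j b = (\<Squnion>i\<in>I. f i \<sqinter> j b)"
  by (simp add: Sup_inf_closure image_image)

end

end

theory Submission
  imports Defs
begin

text \<open>
  Write \<open>x\<close> for a fixed point of \<open>j\<close>, so that \<open>x = j x\<close>. The last condition on \<open>j\<close> says that
  meeting with \<open>x\<close> distributes over all joins of \<open>L\<close>. Applied to \<open>\<top> = a \<squnion> - a\<close>, for an arbitrary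
  \<open>a\<close>, it gives \<open>x = (a \<sqinter> x) \<squnion> (- a \<sqinter> x)\<close>. If \<open>a \<sqinter> x = \<bottom>\<close>, then \<open>x = - a \<sqinter> x\<close>, that is, \<open>a \<le> - x\<close>:
  being disjoint from a fixed point is the same as being
  orthogonal to it (\<open>le_uminus_fixed_if_disjoint\<close>).

  Joins of fixed points are fixed because \<open>j\<close> preserves joins, and meets are fixed because \<open>j\<close> is a
  closure operation. For complements, \<open>j (- x)\<close> is disjoint from \<open>x\<close>, since
  \<open>j (- x) \<sqinter> x = j (- x \<sqinter> x) = j \<bottom> = \<bottom>\<close>, so it lies below \<open>- x\<close>. Boolean distributivity is the
  distributivity above together with its dual. Finally, one half of centrality of \<open>x\<close> is the
  distributivity of meeting with \<open>x\<close>, and the other half follows because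
  \<open>(x \<squnion> - b) \<sqinter> b\<close> is disjoint from the fixed point \<open>- x\<close>.
\<close>

context borceux_van_den_bossche
begin

text \<open>This is the distributivity of \<open>a \<sqinter> j (\<Squnion>B)\<close> at \<open>a = \<top>\<close>; the empty family gives \<open>j \<bottom> = \<bottom>\<close>.\<close>

lemma closure_Sup: "j (\<Squnion>B) = (\<Squnion>b\<in>B. j b)"
  using inf_closure_Sup[of \<top> B] by simp

lemma closure_bot: "j \<bottom> = \<bottom>"
  using closure_Sup[of "{}"] by simp

lemma fixed_Sup:
  assumes "\<And>a. a \<in> A \<Longrightarrow> j a = a"
  shows "j (\<Squnion>A) = \<Squnion>A"
  using assms by (simp add: closure_Sup)

lemma fixed_Inf:
  assumes "\<And>a. a \<in> A \<Longrightarrow> j a = a"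
  shows "j (\<Sqinter>A) = \<Sqinter>A"
proof (rule antisym)
  show "j (\<Sqinter>A) \<le> \<Sqinter>A"
  proof (rule Inf_greatest)
    fix a assume "a \<in> A"
    then have "j (\<Sqinter>A) \<le> j a"
      by (intro monoD[OF mono_closure] Inf_lower)
    with assms[OF \<open>a \<in> A\<close>] show "j (\<Sqinter>A) \<le> a" by simp
  qed
qed (rule closure_increasing)

lemma fixed_sup: "j x = x \<Longrightarrow> j y = y \<Longrightarrow> j (x \<squnion> y) = x \<squnion> y"
  using fixed_Sup[of "{x, y}"] by auto

lemma fixed_inf: "j x = x \<Longrightarrow> j y = y \<Longrightarrow> j (x \<sqinter> y) = x \<sqinter> y"
  using fixed_Inf[of "{x, y}"] by auto

lemma sup_inf_fixed:
  assumes "j x = x"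
  shows "(a \<squnion> b) \<sqinter> x = (a \<sqinter> x) \<squnion> (b \<sqinter> x)"
  using Sup_inf_closure[of "{a, b}" x] assms by simp

end

locale orthomodular_borceux_van_den_bossche = borceux_van_den_bossche j
  for j :: "'a::complete_orthomodular_lattice \<Rightarrow> 'a"
begin

text \<open>
  In a general orthomodular lattice disjointness is weaker than orthogonality; they agree for
  a fixed point \<open>x\<close> because \<open>x\<close> is the join of its parts below \<open>a\<close> and below \<open>- a\<close>.
\<close>

lemma le_uminus_fixed_if_disjoint:
  assumes "j x = x" and "a \<sqinter> x = \<bottom>"
  shows "a \<le> - x"
proof -
  have "x = (a \<squnion> - a) \<sqinter> x" by simp
  also have "\<dots> = - a \<sqinter> x"
    unfolding sup_inf_fixed[OF assms(1)] assms(2) by simp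
  finally have "x \<le> - a" by (simp add: inf.absorb_iff2)
  then show ?thesis by (rule compl_le_swap1)
qed

lemma fixed_uminus:
  assumes "j x = x"
  shows "j (- x) = - x"
proof (rule antisym)
  have "j (- x) \<sqinter> x = j (- x \<sqinter> x)"
    using closure_inf_closure[of "- x" x] assms by simp
  also have "\<dots> = \<bottom>" by (simp add: closure_bot)
  finally show "j (- x) \<le> - x"
    by (rule le_uminus_fixed_if_disjoint[OF assms])
qed (rule closure_increasing)

text \<open>The dual of \<open>sup_inf_fixed\<close>: complementation exchanges joins and meets and
  preserves fixed points.\<close>

lemma inf_sup_fixed:
  assumes "j x = x"
  shows "(a \<sqinter> b) \<squnion> x = (a \<squnion> x) \<sqinter> (b \<squnion> x)"
proof -
  have "- ((a \<sqinter> b) \<squnion> x) = - ((a \<squnion> x) \<sqinter> (b \<squnion> x))"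
    using sup_inf_fixed[OF fixed_uminus[OF assms], of "- a" "- b"] by simp
  then show ?thesis by (simp only: compl_eq_compl_iff)
qed

lemma fixed_in_center:
  assumes "j x = x"
  shows "x \<in> center"
proof -
  have "sasaki_and x b = x \<sqinter> b" for b
  proof (rule antisym)
    have "sasaki_and x b \<sqinter> - x = ((x \<squnion> - b) \<sqinter> - x) \<sqinter> b"
      by (simp only: sasaki_and_def ac_simps)
    also have "\<dots> = (- b \<sqinter> - x) \<sqinter> b"
      by (simp add: sup_inf_fixed[OF fixed_uminus[OF assms]])
    also have "\<dots> = (b \<sqinter> - b) \<sqinter> - x" by (simp only: ac_simps)
    also have "\<dots> = \<bottom>" by simp
    finally have "sasaki_and x b \<le> - (- x)"
      by (rule le_uminus_fixed_if_disjoint[OF fixed_uminus[OF assms]])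
    then show "sasaki_and x b \<le> x \<sqinter> b"
      by (simp add: sasaki_and_def)
    show "x \<sqinter> b \<le> sasaki_and x b"
      by (simp add: sasaki_and_def le_infI1)
  qed
  moreover have "sasaki_and b x = x \<sqinter> b" for b
    unfolding sasaki_and_def sup_inf_fixed[OF assms] by (simp add: inf.commute)
  ultimately show ?thesis by (simp add: center_def)
qed

lemma boolean_algebra_on_fixed:
  "boolean_algebra_on {x. j x = x} (\<sqinter>) (\<squnion>) uminus \<bottom> \<top>"
proof
  show "\<bottom> \<in> {x. j x = x}" by (simp add: closure_bot)
  show "\<top> \<in> {x. j x = x}" using fixed_Inf[of "{}"] by simp
  fix x assume x: "x \<in> {x. j x = x}"
  then show "- x \<in> {x. j x = x}" by (simp add: fixed_uminus)
  fix y assume "y \<in> {x. j x = x}"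
  with x show "x \<sqinter> y \<in> {x. j x = x}" and "x \<squnion> y \<in> {x. j x = x}"
    by (simp_all add: fixed_inf fixed_sup)
  fix z
  show "x \<sqinter> (y \<squnion> z) = (x \<sqinter> y) \<squnion> (x \<sqinter> z)"
    using x sup_inf_fixed[of x y z] by (simp add: inf.commute)
  show "x \<squnion> (y \<sqinter> z) = (x \<squnion> y) \<sqinter> (x \<squnion> z)"
    using x inf_sup_fixed[of x y z] by (simp add: sup.commute)
qed (simp_all add: ac_simps)

lemma complete_boolean_sublattice_fixed: "complete_boolean_sublattice {x. j x = x}"
  unfolding complete_boolean_sublattice_def
  using boolean_algebra_on_fixed by (auto intro!: fixed_Sup fixed_Inf fixed_uminus)

end

theorem proposition8:
  fixes j :: "'a::complete_orthomodular_lattice \<Rightarrow> 'a"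
  assumes "borceux_van_den_bossche j"
  shows "complete_boolean_sublattice {x. j x = x} \<and> {x. j x = x} \<subseteq> center"
proof -
  interpret orthomodular_borceux_van_den_bossche j
    using assms by (rule orthomodular_borceux_van_den_bossche.intro)
  show ?thesis
    using complete_boolean_sublattice_fixed fixed_in_center by blast
qed

end
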